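(* Let $G$ be a simply connected nilpotent Lie group of dimension $n$ equipped with a left-invariant Riemannian metric $h$. The space of left-invariant conformal vector fields on $(G,h)$ coincides with the space of left-invariant Killing vector fields on $(G,h)$.
   Context: A vector field $X$ on a Riemannian manifold $(M,g)$ is a Killing field if $\mathcal{L}_X g=0$, where $\mathcal{L}_X$ is the Lie derivative with respect to $X$. A vector field $X$ on $(M,g)$ is called conformal if the local one-parameter group of diffeomorphisms $\{\phi_t\}$ generated by $X$ satisfies $\phi_t^*g=e^{2\psi_t}g$ for some smooth functions $\psi_t$. Equivalently (a known fact), $\mathcal{L}_Xg=2fg$ for some smooth function $f$ on $M$; equivalently, $\mathcal{L}_Xg=\frac{2\operatorname{div}(X)}{n}g$ with $n=\dim M$. *)

theory Defs
  imports "HOL-Analysis.Analysis" "HOL-Algebra.Generated_Groups"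
begin

section \<open>Smooth functions between Euclidean spaces\<close>

text \<open>\<open>C_on k S f\<close> says that \<open>f\<close> is of class \<open>C\<^sup>k\<close> on \<open>S\<close>. It is meant for open \<open>S\<close>; the values of
  \<open>f\<close> outside an open \<open>S\<close> do not matter.\<close>

primrec C_on :: "nat \<Rightarrow> 'a::euclidean_space set \<Rightarrow> ('a \<Rightarrow> 'b::euclidean_space) \<Rightarrow> bool" where
  "C_on 0 S f \<longleftrightarrow> continuous_on S f"
| "C_on (Suc k) S f \<longleftrightarrow>
     (\<forall>x\<in>S. f differentiable (at x)) \<and> (\<forall>v. C_on k S (\<lambda>x. frechet_derivative f (at x) v))"

definition smooth_on :: "'a::euclidean_space set \<Rightarrow> ('a \<Rightarrow> 'b::euclidean_space) \<Rightarrow> bool" where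
  "smooth_on S f \<longleftrightarrow> (\<forall>k. C_on k S f)"


section \<open>Smooth manifolds and smooth maps\<close>

text \<open>A chart is a pair of an open domain and a coordinate map; only the values of the coordinate
  map on the domain matter. The underlying set of a manifold is a whole type, which carries its
  topology (Hausdorff and second countable by type class in the theorem). A smooth structure is
  given by any atlas of smoothly compatible charts; the atlas need not be maximal.\<close>

type_synonym ('m, 'e) chart = "'m set \<times> ('m \<Rightarrow> 'e)"

definition chart_inv :: "('m, 'e) chart \<Rightarrow> 'e \<Rightarrow> 'm" where
  "chart_inv c = inv_into (fst c) (snd c)"

definition local_rep :: "('m, 'e) chart \<Rightarrow> ('n, 'f) chart \<Rightarrow> ('m \<Rightarrow> 'n) \<Rightarrow> 'e \<Rightarrow> 'f" where
  "local_rep c d f = snd d \<circ> f \<circ> chart_inv c"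

definition smooth_atlas :: "('m::topological_space, 'e::euclidean_space) chart set \<Rightarrow> bool" where
  "smooth_atlas A \<longleftrightarrow>
     (\<Union>c\<in>A. fst c) = UNIV \<and>
     (\<forall>c\<in>A. open (fst c) \<and> open (snd c ` fst c) \<and>
             homeomorphism (fst c) (snd c ` fst c) (snd c) (chart_inv c)) \<and>
     (\<forall>c\<in>A. \<forall>d\<in>A. smooth_on (snd c ` (fst c \<inter> fst d)) (local_rep c d id))"

definition prod_atlas ::
  "('m, 'e) chart set \<Rightarrow> ('n, 'f) chart set \<Rightarrow> ('m \<times> 'n, 'e \<times> 'f) chart set" where
  "prod_atlas A B = {(fst c \<times> fst d, map_prod (snd c) (snd d)) |c d. c \<in> A \<and> d \<in> B}"

definition euclidean_atlas :: "('e, 'e) chart set" where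
  "euclidean_atlas = {(UNIV, id)}"

text \<open>Smoothness of \<open>f\<close> on an open subset \<open>S\<close> of a manifold.\<close>

definition smooth_map_on ::
  "('m::topological_space, 'e::euclidean_space) chart set \<Rightarrow>
   ('n::topological_space, 'f::euclidean_space) chart set \<Rightarrow> 'm set \<Rightarrow> ('m \<Rightarrow> 'n) \<Rightarrow> bool" where
  "smooth_map_on A B S f \<longleftrightarrow>
     continuous_on S f \<and>
     (\<forall>c\<in>A. \<forall>d\<in>B. smooth_on (snd c ` (fst c \<inter> S \<inter> f -` fst d)) (local_rep c d f))"


section \<open>Tangent vectors and vector fields\<close>

text \<open>A tangent vector at \<open>p\<close> is the family of its coordinate vectors in all charts around \<open>p\<close>, subject
  to the usual transformation law. For charts that do not contain \<open>p\<close> the entry is set to zero, so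
  that equality of tangent vectors is equality of functions.\<close>

type_synonym ('m, 'e) tangent = "('m, 'e) chart \<Rightarrow> 'e"

definition tangent_space ::
  "('m, 'e::euclidean_space) chart set \<Rightarrow> 'm \<Rightarrow> ('m, 'e) tangent set" where
  "tangent_space A p =
     {v. (\<forall>c\<in>A. \<forall>d\<in>A. p \<in> fst c \<and> p \<in> fst d \<longrightarrow>
            v d = frechet_derivative (local_rep c d id) (at (snd c p)) (v c)) \<and>
         (\<forall>c. c \<notin> A \<or> p \<notin> fst c \<longrightarrow> v c = 0)}"

text \<open>The tangent vector at \<open>p\<close> with coordinates \<open>u\<close> in the chart \<open>c\<close>.\<close>

definition tangent_of_coords ::
  "('m, 'e::euclidean_space) chart set \<Rightarrow> ('m, 'e) chart \<Rightarrow> 'm \<Rightarrow> 'e \<Rightarrow> ('m, 'e) tangent" where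
  "tangent_of_coords A c p u =
     (\<lambda>d. if d \<in> A \<and> p \<in> fst d
          then frechet_derivative (local_rep c d id) (at (snd c p)) u else 0)"

text \<open>The differential of \<open>f\<close> at \<open>p\<close>. By the chain rule it does not depend on the choice of the chart \<open>c\<close>
  around \<open>p\<close> when \<open>v\<close> is a tangent vector at \<open>p\<close> and \<open>f\<close> is smooth near \<open>p\<close>.\<close>

definition differential ::
  "('m, 'e::euclidean_space) chart set \<Rightarrow> ('n, 'f::euclidean_space) chart set \<Rightarrow>
   ('m \<Rightarrow> 'n) \<Rightarrow> 'm \<Rightarrow> ('m, 'e) tangent \<Rightarrow> ('n, 'f) tangent" where
  "differential A B f p v =
     (let c = (SOME c. c \<in> A \<and> p \<in> fst c) in
       (\<lambda>d. if d \<in> B \<and> f p \<in> fst d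
            then frechet_derivative (local_rep c d f) (at (snd c p)) (v c) else 0))"

definition smooth_vector_field ::
  "('m::topological_space, 'e::euclidean_space) chart set \<Rightarrow> ('m \<Rightarrow> ('m, 'e) tangent) \<Rightarrow> bool" where
  "smooth_vector_field A X \<longleftrightarrow>
     (\<forall>p. X p \<in> tangent_space A p) \<and>
     (\<forall>c\<in>A. smooth_on (snd c ` fst c) (\<lambda>x. X (chart_inv c x) c))"

text \<open>\<open>\<phi> t p\<close> is, for \<open>t \<in> {-\<epsilon><..<\<epsilon>}\<close> and \<open>p\<close> in the open set \<open>U\<close>, the local one-parameter group
  of diffeomorphisms generated by \<open>X\<close>: a smooth map whose orbits are integral curves of \<open>X\<close>. For a
  smooth field, such \<open>\<epsilon>\<close>, \<open>U\<close>, \<open>\<phi>\<close> exist around every point, and by uniqueness of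
  integral curves any two of them agree for the common times and points and satisfy
  \<open>\<phi> (s + t) p = \<phi> s (\<phi> t p)\<close> wherever both sides are defined.\<close>

definition local_flow ::
  "('m::topological_space, 'e::euclidean_space) chart set \<Rightarrow> ('m \<Rightarrow> ('m, 'e) tangent) \<Rightarrow>
   real \<Rightarrow> 'm set \<Rightarrow> (real \<Rightarrow> 'm \<Rightarrow> 'm) \<Rightarrow> bool" where
  "local_flow A X \<epsilon> U \<phi> \<longleftrightarrow>
     0 < \<epsilon> \<and> open U \<and>
     smooth_map_on (prod_atlas euclidean_atlas A) A ({-\<epsilon><..<\<epsilon>} \<times> U) (\<lambda>(t, p). \<phi> t p) \<and>
     (\<forall>p\<in>U. \<phi> 0 p = p) \<and>
     (\<forall>t\<in>{-\<epsilon><..<\<epsilon>}. \<forall>p\<in>U. \<forall>c\<in>A. \<phi> t p \<in> fst c \<longrightarrow>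
        ((\<lambda>s. snd c (\<phi> s p)) has_vector_derivative X (\<phi> t p) c) (at t))"


section \<open>Riemannian metrics, Killing fields and conformal fields\<close>

type_synonym ('m, 'e) metric = "'m \<Rightarrow> ('m, 'e) tangent \<Rightarrow> ('m, 'e) tangent \<Rightarrow> real"

definition riemannian_metric ::
  "('m::topological_space, 'e::euclidean_space) chart set \<Rightarrow> ('m, 'e) metric \<Rightarrow> bool" where
  "riemannian_metric A h \<longleftrightarrow>
     (\<forall>p. \<forall>u\<in>tangent_space A p. \<forall>v\<in>tangent_space A p. h p u v = h p v u) \<and>
     (\<forall>p. \<forall>u\<in>tangent_space A p. \<forall>v\<in>tangent_space A p. \<forall>w\<in>tangent_space A p. \<forall>a b.
        h p (\<lambda>c. a *\<^sub>R u c + b *\<^sub>R v c) w = a * h p u w + b * h p v w) \<and>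
     (\<forall>p. \<forall>v\<in>tangent_space A p. v \<noteq> (\<lambda>c. 0) \<longrightarrow> 0 < h p v v) \<and>
     (\<forall>c\<in>A. \<forall>i\<in>Basis. \<forall>j\<in>Basis.
        smooth_on (snd c ` fst c)
          (\<lambda>x. h (chart_inv c x) (tangent_of_coords A c (chart_inv c x) i)
                                 (tangent_of_coords A c (chart_inv c x) j)))"

definition pullback ::
  "('m, 'e::euclidean_space) chart set \<Rightarrow> ('m \<Rightarrow> 'm) \<Rightarrow> ('m, 'e) metric \<Rightarrow> ('m, 'e) metric" where
  "pullback A f h p v w = h (f p) (differential A A f p v) (differential A A f p w)"

text \<open>The Lie derivative \<open>(L\<^sub>X h)\<^sub>p(v, w)\<close> equals \<open>D\<close>: the derivative at time 0 of the pullback of \<open>h\<close>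
  along the flow of \<open>X\<close> near \<open>p\<close>. By uniqueness of flows \<open>D\<close> does not depend on the choice of the
  local flow.\<close>

definition has_lie_derivative_metric ::
  "('m::topological_space, 'e::euclidean_space) chart set \<Rightarrow> ('m \<Rightarrow> ('m, 'e) tangent) \<Rightarrow>
   ('m, 'e) metric \<Rightarrow> 'm \<Rightarrow> ('m, 'e) tangent \<Rightarrow> ('m, 'e) tangent \<Rightarrow> real \<Rightarrow> bool" where
  "has_lie_derivative_metric A X h p v w D \<longleftrightarrow>
     (\<exists>\<epsilon> U \<phi>. local_flow A X \<epsilon> U \<phi> \<and> p \<in> U \<and>
        ((\<lambda>t. pullback A (\<phi> t) h p v w) has_real_derivative D) (at 0))"

definition killing_field ::
  "('m::topological_space, 'e::euclidean_space) chart set \<Rightarrow> ('m, 'e) metric \<Rightarrow>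
   ('m \<Rightarrow> ('m, 'e) tangent) \<Rightarrow> bool" where
  "killing_field A h X \<longleftrightarrow>
     smooth_vector_field A X \<and>
     (\<forall>p. \<forall>v\<in>tangent_space A p. \<forall>w\<in>tangent_space A p. has_lie_derivative_metric A X h p v w 0)"

text \<open>Near every point, the local one-parameter group \<open>\<phi>\<close> generated by \<open>X\<close> satisfies
  \<open>\<phi>\<^sub>t\<^sup>* h = exp (2 \<psi>\<^sub>t) h\<close> with smooth functions \<open>\<psi>\<^sub>t\<close>.\<close>

definition conformal_field ::
  "('m::topological_space, 'e::euclidean_space) chart set \<Rightarrow> ('m, 'e) metric \<Rightarrow>
   ('m \<Rightarrow> ('m, 'e) tangent) \<Rightarrow> bool" where
  "conformal_field A h X \<longleftrightarrow>
     smooth_vector_field A X \<and>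
     (\<forall>p. \<exists>\<epsilon> U \<phi>. local_flow A X \<epsilon> U \<phi> \<and> p \<in> U \<and>
        (\<exists>\<psi>. \<forall>t\<in>{-\<epsilon><..<\<epsilon>}.
           smooth_map_on A euclidean_atlas U (\<psi> t) \<and>
           (\<forall>q\<in>U. \<forall>v\<in>tangent_space A q. \<forall>w\<in>tangent_space A q.
              pullback A (\<phi> t) h q v w = exp (2 * \<psi> t q) * h q v w)))"


section \<open>Lie groups\<close>

definition lie_group ::
  "('g::topological_space, 'x) monoid_scheme \<Rightarrow> ('g, 'e::euclidean_space) chart set \<Rightarrow> bool" where
  "lie_group G A \<longleftrightarrow>
     group G \<and> carrier G = UNIV \<and> smooth_atlas A \<and>
     smooth_map_on (prod_atlas A A) A UNIV (\<lambda>(x, y). x \<otimes>\<^bsub>G\<^esub> y) \<and>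
     smooth_map_on A A UNIV (\<lambda>x. inv\<^bsub>G\<^esub> x)"

primrec lower_central_series :: "('g, 'x) monoid_scheme \<Rightarrow> nat \<Rightarrow> 'g set" where
  "lower_central_series G 0 = carrier G"
| "lower_central_series G (Suc k) =
     generate G (\<Union>x\<in>lower_central_series G k. \<Union>y\<in>carrier G.
       {x \<otimes>\<^bsub>G\<^esub> y \<otimes>\<^bsub>G\<^esub> inv\<^bsub>G\<^esub> x \<otimes>\<^bsub>G\<^esub> inv\<^bsub>G\<^esub> y})"

definition nilpotent_group :: "('g, 'x) monoid_scheme \<Rightarrow> bool" where
  "nilpotent_group G \<longleftrightarrow> group G \<and> (\<exists>k. lower_central_series G k = {\<one>\<^bsub>G\<^esub>})"

definition left_invariant_metric ::
  "('g, 'x) monoid_scheme \<Rightarrow> ('g, 'e::euclidean_space) chart set \<Rightarrow> ('g, 'e) metric \<Rightarrow> bool" where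
  "left_invariant_metric G A h \<longleftrightarrow>
     (\<forall>g p. \<forall>v\<in>tangent_space A p. \<forall>w\<in>tangent_space A p.
        pullback A (\<lambda>x. g \<otimes>\<^bsub>G\<^esub> x) h p v w = h p v w)"

definition left_invariant_field ::
  "('g::topological_space, 'x) monoid_scheme \<Rightarrow> ('g, 'e::euclidean_space) chart set \<Rightarrow>
   ('g \<Rightarrow> ('g, 'e) tangent) \<Rightarrow> bool" where
  "left_invariant_field G A X \<longleftrightarrow>
     smooth_vector_field A X \<and>
     (\<forall>g p. differential A A (\<lambda>x. g \<otimes>\<^bsub>G\<^esub> x) p (X p) = X (g \<otimes>\<^bsub>G\<^esub> p))"

end

theory Submission
  imports Defs
begin

text \<open>Let \<open>X\<close> be left-invariant. Left translations carry integral curves of \<open>X\<close> to integral curves, so by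
  uniqueness of integral curves every local flow of \<open>X\<close> consists of right translations: \<open>\<phi>\<^sub>t q = q a\<^sub>t\<close>,
  where \<open>a\<^sub>t\<close> is an integral curve through \<open>1\<close>
  (\<open>left_invariant_flow_is_right_translation\<close>). The theorem becomes a statement about the right
  translations \<open>R\<^bsub>a\<^esub>\<close>, \<open>a = a\<^sub>t\<close>.

  Conformal fields are Killing. Suppose that \<open>R\<^bsub>a\<^esub>\<^sup>* h = e\<^sup>2\<^sup>\<psi> h\<close> at \<open>p\<close>. By left invariance of \<open>h\<close>,
  the length of the image of a vector at \<open>1\<close>, translated to \<open>p\<close> and pushed by \<open>R\<^bsub>a\<^esub>\<close>, is the length of
  its image under \<open>Ad(a\<^sup>-\<^sup>1)\<close>. It is therefore enough to find one nonzero fixed vector of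
  \<open>Ad(b)\<close>, for \<open>b = a\<^sup>-\<^sup>1\<close>: its length is preserved, and hence \<open>e\<^sup>2\<^sup>\<psi> = 1\<close>. The fixed vector comes from
  nilpotency without passing to the Lie algebra. The map \<open>\<kappa>(x) = x b x\<^sup>-\<^sup>1 b\<^sup>-\<^sup>1\<close> satisfies
  \<open>\<kappa>(x) \<cdot> (b x b\<^sup>-\<^sup>1) = x\<close>, so its derivative at \<open>1\<close> is \<open>D = I - Ad(b)\<close>. The \<open>k\<close>-th iterate of \<open>\<kappa>\<close> takes
  values in the \<open>k\<close>-th term of the lower central series, so some iterate is constant and \<open>D\<close> is
  nilpotent. A nilpotent linear map has a nonzero kernel, and the kernel of \<open>D\<close> consists of fixed
  vectors of \<open>Ad(b)\<close>
  (\<open>conjugation_fixes_coordinate_vector\<close>, \<open>right_mult_preserves_some_length\<close>).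

  Killing fields are conformal. The Killing condition says that the derivative of \<open>R\<^bsub>a\<^sub>t\<^esub>\<^sup>* h\<close> vanishes at
  \<open>t = 0\<close>, at every point. Since \<open>a\<^bsub>s+t\<^esub> = a\<^sub>s a\<^sub>t\<close> for small \<open>t\<close>, again by uniqueness of integral curves, the
  derivative of \<open>R\<^bsub>a\<^sub>t\<^esub>\<^sup>* h\<close> at any time \<open>s\<close> is a derivative at time \<open>0\<close> at another point. So it
  vanishes too, the flow is isometric, and \<open>\<psi> = 0\<close> witnesses conformality
  (\<open>killing_flow_derivative_zero\<close>).

  In both directions the hypothesis itself supplies a local flow around each point.\<close>


section \<open>Differentiable maps in charts\<close>

text \<open>The part of the definition of an atlas that the chain rule needs from the middle space. Products of
  atlases inherit it at once, which makes the chain rule applicable to the group multiplication.\<close>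

definition charts_cover :: "('m::topological_space, 'e) chart set \<Rightarrow> bool" where
  "charts_cover A \<longleftrightarrow>
     (\<Union>c\<in>A. fst c) = UNIV \<and> (\<forall>c\<in>A. open (fst c) \<and> inj_on (snd c) (fst c))"

definition differentiable_map ::
  "('m::topological_space, 'e::euclidean_space) chart set \<Rightarrow>
   ('n::topological_space, 'f::euclidean_space) chart set \<Rightarrow> ('m \<Rightarrow> 'n) \<Rightarrow> bool" where
  "differentiable_map A B f \<longleftrightarrow>
     continuous_on UNIV f \<and>
     (\<forall>c\<in>A. \<forall>d\<in>B. \<forall>p. p \<in> fst c \<longrightarrow> f p \<in> fst d \<longrightarrow>
        local_rep c d f differentiable (at (snd c p)))"

abbreviation chart_deriv ::
  "('m, 'e::euclidean_space) chart \<Rightarrow> ('n, 'f::euclidean_space) chart \<Rightarrow> ('m \<Rightarrow> 'n) \<Rightarrow> 'm \<Rightarrow> 'e \<Rightarrow> 'f"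
  where "chart_deriv c d f p \<equiv> frechet_derivative (local_rep c d f) (at (snd c p))"

lemma smooth_atlas_inj: "smooth_atlas A \<Longrightarrow> c \<in> A \<Longrightarrow> inj_on (snd c) (fst c)"
  unfolding smooth_atlas_def homeomorphism_def by (metis inj_on_inverseI)

lemma smooth_atlas_charts_cover: "smooth_atlas A \<Longrightarrow> charts_cover A"
  using smooth_atlas_inj by (auto simp: charts_cover_def smooth_atlas_def)

lemma charts_coverE:
  assumes "charts_cover A"
  obtains c where "c \<in> A" "p \<in> fst c"
  using assms unfolding charts_cover_def by blast

lemma chart_inv_left: "charts_cover A \<Longrightarrow> c \<in> A \<Longrightarrow> p \<in> fst c \<Longrightarrow> chart_inv c (snd c p) = p"
  by (simp add: chart_inv_def charts_cover_def)

lemma local_rep_chart: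
  "charts_cover A \<Longrightarrow> c \<in> A \<Longrightarrow> p \<in> fst c \<Longrightarrow> local_rep c d f (snd c p) = snd d (f p)"
  by (simp add: local_rep_def chart_inv_left)

lemma open_chart_image:
  assumes "smooth_atlas A" "c \<in> A" "open U" "U \<subseteq> fst c"
  shows "open (snd c ` U)"
proof -
  have hom: "homeomorphism (fst c) (snd c ` fst c) (snd c) (chart_inv c)"
    and op: "open (snd c ` fst c)"
    using assms by (auto simp: smooth_atlas_def)
  have "openin (top_of_set (fst c)) U"
    using assms(3,4) by (auto simp: openin_open)
  then have "openin (top_of_set (snd c ` fst c)) (snd c ` U)"
    using homeomorphism_imp_open_map[OF hom] by blast
  then show ?thesis
    using op openin_open_trans by blast
qed

lemma charts_cover_prod_atlas:
  assumes "charts_cover A" "charts_cover B"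
  shows "charts_cover (prod_atlas A B)"
proof -
  have "\<exists>c\<in>prod_atlas A B. z \<in> fst c" for z
  proof -
    obtain c where c: "c \<in> A" "fst z \<in> fst c" using assms(1) by (rule charts_coverE)
    obtain d where d: "d \<in> B" "snd z \<in> fst d" using assms(2) by (rule charts_coverE)
    have "(fst c \<times> fst d, map_prod (snd c) (snd d)) \<in> prod_atlas A B"
      unfolding prod_atlas_def using c d by blast
    moreover have "z \<in> fst (fst c \<times> fst d, map_prod (snd c) (snd d))"
      using c d by (simp add: mem_Times_iff)
    ultimately show ?thesis by blast
  qed
  moreover have "open (fst k) \<and> inj_on (snd k) (fst k)" if k: "k \<in> prod_atlas A B" for k
  proof -
    obtain c d where "c \<in> A" "d \<in> B" and k_eq: "k = (fst c \<times> fst d, map_prod (snd c) (snd d))"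
      using k unfolding prod_atlas_def by blast
    then have "open (fst c)" "open (fst d)" "inj_on (snd c) (fst c)" "inj_on (snd d) (fst d)"
      using assms by (auto simp: charts_cover_def)
    then show ?thesis
      unfolding k_eq by (simp add: open_Times map_prod_inj_on)
  qed
  ultimately show ?thesis
    unfolding charts_cover_def by blast
qed

lemma smooth_map_on_differentiable_map:
  assumes "smooth_map_on A B UNIV f"
  shows "differentiable_map A B f"
proof -
  have "local_rep c d f differentiable (at (snd c p))"
    if "c \<in> A" "d \<in> B" "p \<in> fst c" "f p \<in> fst d" for c d p
  proof -
    have "C_on (Suc 0) (snd c ` (fst c \<inter> UNIV \<inter> f -` fst d)) (local_rep c d f)"
      using assms that by (auto simp: smooth_map_on_def smooth_on_def simp del: C_on.simps)
    then show ?thesis using that by auto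
  qed
  then show ?thesis
    using assms by (auto simp: differentiable_map_def smooth_map_on_def)
qed

lemma differentiable_map_has_derivative:
  assumes "differentiable_map A B f" "c \<in> A" "d \<in> B" "p \<in> fst c" "f p \<in> fst d"
  shows "(local_rep c d f has_derivative chart_deriv c d f p) (at (snd c p))"
  using assms by (simp add: differentiable_map_def frechet_derivative_works[symmetric])

lemma local_rep_chain:
  assumes A: "smooth_atlas A" "c \<in> A" "p \<in> fst c"
    and B: "charts_cover B" "d \<in> B" "f p \<in> fst d"
    and f: "continuous_on UNIV f"
    and F: "(local_rep c d f has_derivative F) (at (snd c p))"
    and G: "(local_rep d e g has_derivative G) (at (snd d (f p)))"
  shows "(local_rep c e (g \<circ> f) has_derivative (G \<circ> F)) (at (snd c p))"
proof -
  note Ac = smooth_atlas_charts_cover[OF A(1)]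
  define S where "S = snd c ` (fst c \<inter> f -` fst d)"
  have "open S"
    unfolding S_def using A B f Ac
    by (intro open_chart_image[OF A(1,2)] open_Int open_vimage) (auto simp: charts_cover_def)
  moreover have "snd c p \<in> S"
    using A B by (auto simp: S_def)
  moreover have "(local_rep d e g \<circ> local_rep c d f) x = local_rep c e (g \<circ> f) x" if "x \<in> S" for x
    using that A B Ac by (auto simp: S_def local_rep_def chart_inv_left)
  moreover have "(local_rep d e g \<circ> local_rep c d f has_derivative (G \<circ> F)) (at (snd c p))"
    using F G A Ac by (intro diff_chain_at) (simp_all add: local_rep_chart)
  ultimately show ?thesis
    using has_derivative_transform_within_open by blast
qed

lemma local_rep_comp_has_derivative:
  assumes A: "smooth_atlas A" and B: "charts_cover B"
    and f: "differentiable_map A B f" and g: "differentiable_map B C g"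
    and c: "c \<in> A" "p \<in> fst c" and d: "d \<in> B" "f p \<in> fst d" and e: "e \<in> C" "g (f p) \<in> fst e"
  shows "(local_rep c e (g \<circ> f) has_derivative
      chart_deriv d e g (f p) \<circ> chart_deriv c d f p) (at (snd c p))"
proof (rule local_rep_chain[where d = d, OF A c B d(1)])
  show "f p \<in> fst d" by (fact d(2))
  show "continuous_on UNIV f"
    using f by (simp add: differentiable_map_def)
qed (use differentiable_map_has_derivative f g c d e in blast)+

lemma differentiable_map_comp:
  assumes A: "smooth_atlas A" and B: "charts_cover B"
    and f: "differentiable_map A B f" and g: "differentiable_map B C g"
  shows "differentiable_map A C (g \<circ> f)"
  unfolding differentiable_map_def
proof (intro conjI ballI allI impI)
  show "continuous_on UNIV (g \<circ> f)"
    using f g unfolding differentiable_map_def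
    by (meson continuous_on_compose continuous_on_subset top_greatest)
next
  fix c e p assume c: "c \<in> A" and e: "e \<in> C" and p: "p \<in> fst c" and q: "(g \<circ> f) p \<in> fst e"
  obtain d where d: "d \<in> B" "f p \<in> fst d"
    using B by (meson charts_coverE)
  have q': "g (f p) \<in> fst e" using q by simp
  show "local_rep c e (g \<circ> f) differentiable (at (snd c p))"
    unfolding differentiable_def
    using local_rep_comp_has_derivative[OF A B f g c p d e q'] by blast
qed

lemma chart_deriv_comp:
  assumes "smooth_atlas A" "charts_cover B"
    and "differentiable_map A B f" "differentiable_map B C g"
    and "c \<in> A" "p \<in> fst c" "d \<in> B" "f p \<in> fst d" "e \<in> C" "g (f p) \<in> fst e"
  shows "chart_deriv c e (g \<circ> f) p v = chart_deriv d e g (f p) (chart_deriv c d f p v)"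
  using frechet_derivative_at[OF local_rep_comp_has_derivative[OF assms]]
  by (metis comp_apply)

lemma local_rep_Pair:
  "local_rep c (fst d \<times> fst e, map_prod (snd d) (snd e)) (\<lambda>x. (f x, g x)) =
   (\<lambda>x. (local_rep c d f x, local_rep c e g x))"
  by (auto simp: local_rep_def)

lemma differentiable_map_Pair:
  assumes f: "differentiable_map A B f" and g: "differentiable_map A C g"
  shows "differentiable_map A (prod_atlas B C) (\<lambda>x. (f x, g x))"
  unfolding differentiable_map_def
proof (intro conjI ballI allI impI)
  show "continuous_on UNIV (\<lambda>x. (f x, g x))"
    using f g by (auto simp: differentiable_map_def intro: continuous_on_Pair)
next
  fix c k p assume c: "c \<in> A" "p \<in> fst c" and k: "k \<in> prod_atlas B C" "(f p, g p) \<in> fst k"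
  obtain d e where de: "d \<in> B" "e \<in> C" and k_eq: "k = (fst d \<times> fst e, map_prod (snd d) (snd e))"
    using k by (auto simp: prod_atlas_def)
  have "local_rep c d f differentiable (at (snd c p))" "local_rep c e g differentiable (at (snd c p))"
    using f g c de k(2) by (auto simp: differentiable_map_def k_eq)
  then show "local_rep c k (\<lambda>x. (f x, g x)) differentiable (at (snd c p))"
    unfolding k_eq local_rep_Pair differentiable_def by (blast intro: has_derivative_Pair)
qed

lemma local_rep_const: "local_rep c d (\<lambda>_. q) = (\<lambda>_. snd d q)"
  by (auto simp: local_rep_def)

lemma differentiable_map_const: "differentiable_map A B (\<lambda>_. q)"
  by (simp add: differentiable_map_def local_rep_const)

lemma chart_deriv_const: "chart_deriv c d (\<lambda>_. q) p v = 0"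
  by (simp add: local_rep_const)

lemma differentiable_map_id:
  assumes A: "smooth_atlas A"
  shows "differentiable_map A A id"
proof -
  have "local_rep c d id differentiable (at (snd c p))"
    if "c \<in> A" "d \<in> A" "p \<in> fst c" "p \<in> fst d" for c d p
  proof -
    have "C_on (Suc 0) (snd c ` (fst c \<inter> fst d)) (local_rep c d id)"
      using assms that by (auto simp: smooth_atlas_def smooth_on_def simp del: C_on.simps)
    then show ?thesis using that by auto
  qed
  then show ?thesis
    using assms by (auto simp: differentiable_map_def smooth_map_on_def)
qed

lemma chart_deriv_id:
  assumes A: "smooth_atlas A" and "c \<in> A" "p \<in> fst c"
  shows "chart_deriv c c id p v = v"
proof -
  have "(local_rep c c id has_derivative id) (at (snd c p))"
  proof (rule has_derivative_transform_within_open[of id])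
    show "open (snd c ` fst c)" "snd c p \<in> snd c ` fst c"
      using assms by (auto simp: smooth_atlas_def)
    show "id x = local_rep c c id x" if "x \<in> snd c ` fst c" for x
      using that assms smooth_atlas_charts_cover by (force simp: local_rep_chart)
  qed (simp add: id_def)
  from frechet_derivative_at[OF this] show ?thesis
    by (auto dest: fun_cong[of id _ v])
qed

lemma C_on_const: "C_on k S (\<lambda>_. q)"
  by (induction k arbitrary: q) simp_all

lemma smooth_map_on_const: "smooth_map_on A B U (\<lambda>_. q)"
  by (simp add: smooth_map_on_def smooth_on_def local_rep_const C_on_const)


section \<open>Tangent vectors and differentials\<close>

lemma tangent_space_transform:
  "v \<in> tangent_space A p \<Longrightarrow> c \<in> A \<Longrightarrow> d \<in> A \<Longrightarrow> p \<in> fst c \<Longrightarrow> p \<in> fst d \<Longrightarrow>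
   v d = chart_deriv c d id p (v c)"
  unfolding tangent_space_def by blast

lemma tangent_space_outside:
  "v \<in> tangent_space A p \<Longrightarrow> c \<notin> A \<or> p \<notin> fst c \<Longrightarrow> v c = 0"
  unfolding tangent_space_def by blast

lemma tangent_spaceI:
  assumes "\<And>c d. c \<in> A \<Longrightarrow> p \<in> fst c \<Longrightarrow> d \<in> A \<Longrightarrow> p \<in> fst d \<Longrightarrow>
      v d = chart_deriv c d id p (v c)"
    and "\<And>c. c \<notin> A \<or> p \<notin> fst c \<Longrightarrow> v c = 0"
  shows "v \<in> tangent_space A p"
  using assms unfolding tangent_space_def by blast

lemma tangent_eqI:
  assumes "v \<in> tangent_space A p" "w \<in> tangent_space A p" "c \<in> A" "p \<in> fst c" "v c = w c"
  shows "v = w"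
proof
  fix d
  show "v d = w d"
  proof (cases "d \<in> A \<and> p \<in> fst d")
    case True
    then show ?thesis
      using tangent_space_transform[OF assms(1,3), of d] tangent_space_transform[OF assms(2,3), of d]
        assms(4,5) by simp
  qed (use tangent_space_outside assms in metis)
qed

lemma zero_in_tangent_space:
  assumes "smooth_atlas A"
  shows "(\<lambda>c. 0) \<in> tangent_space A p"
proof (rule tangent_spaceI)
  fix c d assume "c \<in> A" "p \<in> fst c" "d \<in> A" "p \<in> fst d"
  then show "0 = chart_deriv c d id p 0"
    using differentiable_map_has_derivative[OF differentiable_map_id[OF assms], of c d p]
    by (metis has_derivative_linear linear_0 id_apply)
qed simp

lemma tangent_of_coords_in_tangent_space:
  assumes A: "smooth_atlas A" and c: "c \<in> A" "p \<in> fst c"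
  shows "tangent_of_coords A c p u \<in> tangent_space A p"
proof (rule tangent_spaceI)
  note cov = smooth_atlas_charts_cover[OF A] and d = differentiable_map_id[OF A]
  fix d e assume *: "d \<in> A" "p \<in> fst d" "e \<in> A" "p \<in> fst e"
  have "chart_deriv c e (id \<circ> id) p u = chart_deriv d e id (id p) (chart_deriv c d id p u)"
    by (rule chart_deriv_comp[OF A cov d d c]) (use * in auto)
  then show "tangent_of_coords A c p u e = chart_deriv d e id p (tangent_of_coords A c p u d)"
    using * by (simp add: tangent_of_coords_def)
qed (auto simp: tangent_of_coords_def)

lemma tangent_of_coords_chart:
  assumes "smooth_atlas A" "c \<in> A" "p \<in> fst c"
  shows "tangent_of_coords A c p u c = u"
  using assms chart_deriv_id[OF assms] by (simp add: tangent_of_coords_def)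

text \<open>The definition of the differential selects one chart at \<open>p\<close>; the transformation law of \<open>v\<close> and the chain
  rule for a change of coordinates show that every chart gives the same value.\<close>

lemma differential_chart:
  assumes A: "smooth_atlas A" and f: "differentiable_map A B f"
    and v: "v \<in> tangent_space A p"
    and c: "c \<in> A" "p \<in> fst c" and d: "d \<in> B" "f p \<in> fst d"
  shows "differential A B f p v d = chart_deriv c d f p (v c)"
proof -
  define c0 where "c0 = (SOME c. c \<in> A \<and> p \<in> fst c)"
  have c0: "c0 \<in> A" "p \<in> fst c0"
    using someI[of "\<lambda>c. c \<in> A \<and> p \<in> fst c" c] c by (auto simp: c0_def)
  have "differential A B f p v d = chart_deriv c0 d f p (v c0)"
    using d by (simp add: differential_def c0_def Let_def)
  also have "v c0 = chart_deriv c c0 id p (v c)"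
    by (rule tangent_space_transform[OF v c(1) c0(1) c(2) c0(2)])
  also have "chart_deriv c0 d f p (chart_deriv c c0 id p (v c)) = chart_deriv c d (f \<circ> id) p (v c)"
    using chart_deriv_comp[OF A smooth_atlas_charts_cover[OF A] differentiable_map_id[OF A] f c _ _ d(1),
        of c0 "v c"] c0 d(2) by simp
  finally show ?thesis by simp
qed

lemma differential_in_tangent_space:
  assumes A: "smooth_atlas A" and B: "smooth_atlas B" and f: "differentiable_map A B f"
    and v: "v \<in> tangent_space A p"
  shows "differential A B f p v \<in> tangent_space B (f p)"
proof -
  obtain c where c: "c \<in> A" "p \<in> fst c"
    using smooth_atlas_charts_cover[OF A] by (meson charts_coverE)
  show ?thesis
  proof (rule tangent_spaceI)
    fix d e assume d: "d \<in> B" "f p \<in> fst d" and e: "e \<in> B" "f p \<in> fst e"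
    have "chart_deriv c e (id \<circ> f) p (v c) = chart_deriv d e id (f p) (chart_deriv c d f p (v c))"
      by (rule chart_deriv_comp[OF A smooth_atlas_charts_cover[OF B] f differentiable_map_id[OF B] c d])
        (use e in auto)
    then show "differential A B f p v e = chart_deriv d e id (f p) (differential A B f p v d)"
      unfolding differential_chart[OF A f v c d] differential_chart[OF A f v c e] id_comp .
  qed (auto simp: differential_def Let_def)
qed

lemma differential_comp:
  assumes A: "smooth_atlas A" and B: "smooth_atlas B" and C: "smooth_atlas C"
    and f: "differentiable_map A B f" and g: "differentiable_map B C g"
    and v: "v \<in> tangent_space A p"
  shows "differential A C (g \<circ> f) p v = differential B C g (f p) (differential A B f p v)"
proof -
  note covB = smooth_atlas_charts_cover[OF B]
  note gf = differentiable_map_comp[OF A covB f g]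
  note fv = differential_in_tangent_space[OF A B f v]
  obtain c d e where c: "c \<in> A" "p \<in> fst c" and d: "d \<in> B" "f p \<in> fst d"
    and e: "e \<in> C" "g (f p) \<in> fst e"
    using A B C smooth_atlas_charts_cover by (meson charts_coverE)
  show ?thesis
  proof (rule tangent_eqI[OF _ _ e])
    show "differential A C (g \<circ> f) p v \<in> tangent_space C (g (f p))"
      using differential_in_tangent_space[OF A C gf v] by simp
    show "differential B C g (f p) (differential A B f p v) \<in> tangent_space C (g (f p))"
      by (rule differential_in_tangent_space[OF B C g fv])
    show "differential A C (g \<circ> f) p v e = differential B C g (f p) (differential A B f p v) e"
      unfolding differential_chart[OF B g fv d e] differential_chart[OF A f v c d]
      using chart_deriv_comp[OF A covB f g c d e, of "v c"] differential_chart[OF A gf v c, of e] e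
      by (metis comp_apply)
  qed
qed

lemma differential_id:
  assumes A: "smooth_atlas A" and v: "v \<in> tangent_space A p"
  shows "differential A A id p v = v"
proof -
  note d = differentiable_map_id[OF A]
  obtain c where c: "c \<in> A" "p \<in> fst c"
    using smooth_atlas_charts_cover[OF A] by (meson charts_coverE)
  show ?thesis
  proof (rule tangent_eqI[OF _ v c])
    show "differential A A id p v \<in> tangent_space A p"
      using differential_in_tangent_space[OF A A d v] by simp
    show "differential A A id p v c = v c"
      using differential_chart[OF A d v c c(1)] c chart_deriv_id[OF A c] by simp
  qed
qed

text \<open>Local flows are known only on an open set. This lemma replaces them there by globally defined
  translations.\<close>

lemma differential_cong_open:
  fixes f g :: "'m::topological_space \<Rightarrow> 'n::topological_space"
    and A :: "('m, 'e::euclidean_space) chart set" and B :: "('n, 'f::euclidean_space) chart set"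
  assumes A: "smooth_atlas A" and U: "open U" "p \<in> U" and eq: "\<And>q. q \<in> U \<Longrightarrow> f q = g q"
  shows "differential A B f p v = differential A B g p v"
proof -
  define c where "c = (SOME c. c \<in> A \<and> p \<in> fst c)"
  obtain c' where "c' \<in> A" "p \<in> fst c'"
    using smooth_atlas_charts_cover[OF A] by (meson charts_coverE)
  then have c: "c \<in> A" "p \<in> fst c"
    using someI[of "\<lambda>c. c \<in> A \<and> p \<in> fst c" c'] by (auto simp: c_def)
  define S where "S = snd c ` (fst c \<inter> U)"
  have "open (fst c)"
    using A c by (simp add: smooth_atlas_def)
  then have S: "open S" "snd c p \<in> S"
    unfolding S_def using c U by (auto intro!: open_chart_image[OF A c(1)])
  have eqS: "local_rep c d f x = local_rep c d g x" if "x \<in> S" for x and d :: "('n, 'f) chart"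
    using that eq chart_inv_left[OF smooth_atlas_charts_cover[OF A] c(1)]
    by (auto simp: S_def local_rep_def)
  have "(local_rep c d f has_derivative F) (at (snd c p)) \<longleftrightarrow>
      (local_rep c d g has_derivative F) (at (snd c p))" for d :: "('n, 'f) chart" and F
  proof
    assume "(local_rep c d f has_derivative F) (at (snd c p))"
    from has_derivative_transform_within_open[OF this S eqS]
    show "(local_rep c d g has_derivative F) (at (snd c p))" .
  next
    assume "(local_rep c d g has_derivative F) (at (snd c p))"
    from has_derivative_transform_within_open[OF this S eqS[symmetric]]
    show "(local_rep c d f has_derivative F) (at (snd c p))" .
  qed
  then have deriv_eq: "chart_deriv c d f p = chart_deriv c d g p" for d :: "('n, 'f) chart"
    unfolding frechet_derivative_def by presburger
  have "f p = g p" using eq U by blast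
  then show ?thesis
    unfolding differential_def Let_def c_def[symmetric] deriv_eq by simp
qed


section \<open>Uniqueness of integral curves\<close>

definition integral_curve_on ::
  "('m::topological_space, 'e::euclidean_space) chart set \<Rightarrow> ('m \<Rightarrow> ('m, 'e) tangent) \<Rightarrow>
   real set \<Rightarrow> (real \<Rightarrow> 'm) \<Rightarrow> bool" where
  "integral_curve_on A X I \<gamma> \<longleftrightarrow>
     continuous_on I \<gamma> \<and>
     (\<forall>t\<in>I. \<forall>c\<in>A. \<gamma> t \<in> fst c \<longrightarrow>
        ((\<lambda>s. snd c (\<gamma> s)) has_vector_derivative X (\<gamma> t) c) (at t))"

text \<open>Each partial derivative is continuous, hence bounded on the compact ball; the sum of these bounds
  controls the operator norm of the derivative, and the mean value inequality applies.\<close>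

lemma C_on_imp_Lipschitz_on_cball:
  fixes W :: "'a::euclidean_space \<Rightarrow> 'b::euclidean_space"
  assumes W: "C_on (Suc 0) S W" and sub: "cball x r \<subseteq> S"
  obtains L where "0 < L"
    "\<And>y z. y \<in> cball x r \<Longrightarrow> z \<in> cball x r \<Longrightarrow> norm (W y - W z) \<le> L * norm (y - z)"
proof -
  let ?D = "\<lambda>y. frechet_derivative W (at y)"
  have deriv: "(W has_derivative ?D y) (at y)" if "y \<in> cball x r" for y
    using W sub that by (auto simp: frechet_derivative_works[symmetric])
  have "\<exists>K. \<forall>y\<in>cball x r. norm (?D y b) \<le> K" for b
  proof -
    have "continuous_on (cball x r) (\<lambda>y. ?D y b)"
      using W sub continuous_on_subset by (metis C_on.simps)
    then have "bounded ((\<lambda>y. ?D y b) ` cball x r)"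
      by (intro compact_imp_bounded compact_continuous_image) auto
    then show ?thesis by (auto simp: bounded_iff)
  qed
  then obtain K where K: "\<And>b y. y \<in> cball x r \<Longrightarrow> norm (?D y b) \<le> K b"
    by metis
  define L where "L = 1 + \<bar>\<Sum>b\<in>Basis. K b\<bar>"
  have onorm: "onorm (?D y) \<le> L" if y: "y \<in> cball x r" for y
  proof (rule onorm_le)
    fix v
    have lin: "linear (?D y)"
      using deriv[OF y] has_derivative_linear by blast
    have "norm (?D y v) = norm (?D y (\<Sum>b\<in>Basis. (v \<bullet> b) *\<^sub>R b))"
      by (simp add: euclidean_representation)
    also have "\<dots> = norm (\<Sum>b\<in>Basis. (v \<bullet> b) *\<^sub>R ?D y b)"
      using lin by (simp add: linear_sum linear_scale)
    also have "\<dots> \<le> (\<Sum>b\<in>Basis. norm v * K b)"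
      using K[OF y] Basis_le_norm by (intro sum_norm_le) (auto intro!: mult_mono)
    also have "\<dots> = (\<Sum>b\<in>Basis. K b) * norm v"
      unfolding sum_distrib_right by (simp only: mult.commute)
    also have "\<dots> \<le> L * norm v"
      by (intro mult_right_mono) (auto simp: L_def)
    finally show "norm (?D y v) \<le> L * norm v" .
  qed
  have "norm (W y - W z) \<le> L * norm (y - z)" if "y \<in> cball x r" "z \<in> cball x r" for y z
    by (rule differentiable_bound[of "cball x r" W ?D])
      (use that onorm deriv in \<open>auto intro: has_derivative_at_withinI\<close>)
  moreover have "0 < L" by (simp add: L_def)
  ultimately show thesis using that by blast
qed

text \<open>If \<open>M\<close> is the maximal distance of the two solutions on an interval of radius \<open>\<tau>\<close> around \<open>t0\<close>, the
  mean value inequality gives \<open>M \<le> L \<tau> M\<close>. Hence \<open>M = 0\<close> as soon as \<open>L \<tau> \<le> 1 / 2\<close>.\<close>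

lemma Lipschitz_ode_locally_unique:
  fixes x y :: "real \<Rightarrow> 'a::real_normed_vector"
  assumes lip: "\<And>u v. u \<in> K \<Longrightarrow> v \<in> K \<Longrightarrow> norm (W u - W v) \<le> L * norm (u - v)" and "0 < L"
    and "0 < \<delta>"
    and x: "\<And>t. \<bar>t - t0\<bar> < \<delta> \<Longrightarrow> x t \<in> K \<and> (x has_vector_derivative W (x t)) (at t)"
    and y: "\<And>t. \<bar>t - t0\<bar> < \<delta> \<Longrightarrow> y t \<in> K \<and> (y has_vector_derivative W (y t)) (at t)"
    and init: "x t0 = y t0"
  shows "\<exists>\<tau>>0. \<forall>t. \<bar>t - t0\<bar> < \<tau> \<longrightarrow> x t = y t"
proof -
  define \<tau> where "\<tau> = min (\<delta> / 2) (1 / (2 * L))"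
  have \<tau>: "0 < \<tau>" "\<tau> < \<delta>" "L * \<tau> \<le> 1 / 2"
    using \<open>0 < L\<close> \<open>0 < \<delta>\<close> by (auto simp: \<tau>_def min_def field_simps)
  define u where "u = (\<lambda>t. x t - y t)"
  have near: "\<bar>t - t0\<bar> < \<delta>" if "t \<in> cball t0 \<tau>" for t
    using that \<tau> by (auto simp: dist_real_def)
  have du: "(u has_vector_derivative W (x t) - W (y t)) (at t)" if "t \<in> cball t0 \<tau>" for t
    unfolding u_def using x y near that by (intro has_vector_derivative_diff) auto
  have "continuous_on (cball t0 \<tau>) u"
    using du has_vector_derivative_continuous by (intro continuous_at_imp_continuous_on) blast
  then have "continuous_on (cball t0 \<tau>) (\<lambda>t. norm (u t))"
    by (intro continuous_intros)
  then obtain m where m: "m \<in> cball t0 \<tau>" and max: "\<And>t. t \<in> cball t0 \<tau> \<Longrightarrow> norm (u t) \<le> norm (u m)"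
    using continuous_attains_sup[of "cball t0 \<tau>" "\<lambda>t. norm (u t)"] \<tau> by auto
  have "norm (u m - u t0) \<le> (L * norm (u m)) * norm (m - t0)"
  proof (rule differentiable_bound[of "cball t0 \<tau>" u "\<lambda>t h. h *\<^sub>R (W (x t) - W (y t))"])
    fix t assume t: "t \<in> cball t0 \<tau>"
    show "(u has_derivative (\<lambda>h. h *\<^sub>R (W (x t) - W (y t)))) (at t within cball t0 \<tau>)"
      using du[OF t] by (auto simp: has_vector_derivative_def intro: has_derivative_at_withinI)
    have "norm (W (x t) - W (y t)) \<le> L * norm (u t)"
      unfolding u_def using x y near[OF t] by (intro lip) auto
    also have "\<dots> \<le> L * norm (u m)"
      using max[OF t] \<open>0 < L\<close> by simp
    finally show "onorm (\<lambda>h. h *\<^sub>R (W (x t) - W (y t))) \<le> L * norm (u m)"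
      by (intro onorm_le) (auto simp: mult.commute intro!: mult_left_mono)
  qed (use m \<tau> in auto)
  also have "\<dots> \<le> (L * norm (u m)) * \<tau>"
    using m \<open>0 < L\<close> by (intro mult_left_mono) (auto simp: dist_real_def)
  also have "\<dots> = (L * \<tau>) * norm (u m)"
    by simp
  also have "\<dots> \<le> 1 / 2 * norm (u m)"
    using \<tau> by (intro mult_right_mono) auto
  finally have "norm (u m) = 0"
    using init by (simp add: u_def)
  then have "u t = 0" if "\<bar>t - t0\<bar> < \<tau>" for t
    using max[of t] that by (simp add: dist_real_def abs_minus_commute)
  then show ?thesis
    using \<tau> by (auto simp: u_def)
qed

lemma integral_curve_locally_unique:
  assumes A: "smooth_atlas A" and X: "smooth_vector_field A X" and I: "open I"
    and \<gamma>: "integral_curve_on A X I \<gamma>" and \<eta>: "integral_curve_on A X I \<eta>"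
    and s: "s \<in> I" "\<gamma> s = \<eta> s"
  shows "\<exists>\<tau>>0. \<forall>t. \<bar>t - s\<bar> < \<tau> \<longrightarrow> t \<in> I \<and> \<gamma> t = \<eta> t"
proof -
  note cov = smooth_atlas_charts_cover[OF A]
  obtain c where c: "c \<in> A" "\<gamma> s \<in> fst c"
    using cov by (rule charts_coverE)
  define W where "W = (\<lambda>x. X (chart_inv c x) c)"
  have W: "W (snd c p) = X p c" if "p \<in> fst c" for p
    using that chart_inv_left[OF cov c(1)] by (simp add: W_def)
  have chart: "open (fst c)" "open (snd c ` fst c)" "continuous_on (fst c) (snd c)"
    using A c by (auto simp: smooth_atlas_def homeomorphism_def)
  then obtain r where r: "0 < r" "cball (snd c (\<gamma> s)) r \<subseteq> snd c ` fst c"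
    using c by (meson image_eqI open_contains_cball)
  have "C_on (Suc 0) (snd c ` fst c) W"
    using X c unfolding W_def smooth_vector_field_def smooth_on_def by blast
  then obtain L where L: "0 < L" "\<And>y z. y \<in> cball (snd c (\<gamma> s)) r \<Longrightarrow>
      z \<in> cball (snd c (\<gamma> s)) r \<Longrightarrow> norm (W y - W z) \<le> L * norm (y - z)"
    using C_on_imp_Lipschitz_on_cball r(2) by metis
  define V where "V = snd c -` ball (snd c (\<gamma> s)) r \<inter> fst c"
  have V: "open V"
    unfolding V_def using chart continuous_on_open_vimage by blast
  have pre: "open (\<zeta> -` V \<inter> I)" if "integral_curve_on A X I \<zeta>" for \<zeta>
    using that V I continuous_on_open_vimage[OF I] by (auto simp: integral_curve_on_def)
  have "open ((\<gamma> -` V \<inter> I) \<inter> (\<eta> -` V \<inter> I))"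
    using pre \<gamma> \<eta> by blast
  moreover have "s \<in> (\<gamma> -` V \<inter> I) \<inter> (\<eta> -` V \<inter> I)"
    using s c r by (auto simp: V_def)
  ultimately obtain \<delta> where \<delta>: "0 < \<delta>" "ball s \<delta> \<subseteq> (\<gamma> -` V \<inter> I) \<inter> (\<eta> -` V \<inter> I)"
    using open_contains_ball by meson
  then have near: "t \<in> I \<and> \<gamma> t \<in> V \<and> \<eta> t \<in> V" if "\<bar>t - s\<bar> < \<delta>" for t
    using that by (auto simp: subset_iff dist_real_def abs_minus_commute)
  have flow: "snd c (\<zeta> t) \<in> cball (snd c (\<gamma> s)) r \<and>
      ((\<lambda>t. snd c (\<zeta> t)) has_vector_derivative W (snd c (\<zeta> t))) (at t)"
    if "integral_curve_on A X I \<zeta>" "t \<in> I" "\<zeta> t \<in> V" for \<zeta> t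
    using that c W by (auto simp: integral_curve_on_def V_def)
  have "\<exists>\<tau>>0. \<forall>t. \<bar>t - s\<bar> < \<tau> \<longrightarrow> snd c (\<gamma> t) = snd c (\<eta> t)"
  proof (rule Lipschitz_ode_locally_unique[OF L(2,1) \<delta>(1)])
    show "snd c (\<gamma> s) = snd c (\<eta> s)" using s by simp
  qed (use flow \<gamma> \<eta> near in blast)+
  then obtain \<tau> where \<tau>: "0 < \<tau>" "\<And>t. \<bar>t - s\<bar> < \<tau> \<Longrightarrow> snd c (\<gamma> t) = snd c (\<eta> t)"
    by blast
  have "t \<in> I \<and> \<gamma> t = \<eta> t" if "\<bar>t - s\<bar> < min \<tau> \<delta>" for t
    using that near[of t] \<tau>(2)[of t] smooth_atlas_inj[OF A c(1)] by (auto simp: V_def inj_on_def)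
  then show ?thesis
    using \<tau> \<delta> by (intro exI[of _ "min \<tau> \<delta>"]) auto
qed

text \<open>The times at which the two curves agree form an open set by local uniqueness, and the times at which
  they differ form an open set because the space is Hausdorff. The interval is connected.\<close>

lemma integral_curve_unique:
  fixes \<gamma> \<eta> :: "real \<Rightarrow> 'm::t2_space"
  assumes A: "smooth_atlas A" and X: "smooth_vector_field A X" and I: "open I" "connected I"
    and \<gamma>: "integral_curve_on A X I \<gamma>" and \<eta>: "integral_curve_on A X I \<eta>"
    and s: "s \<in> I" "\<gamma> s = \<eta> s" and t: "t \<in> I"
  shows "\<gamma> t = \<eta> t"
proof -
  define E where "E = {t \<in> I. \<gamma> t = \<eta> t}"
  define N where "N = {t \<in> I. \<gamma> t \<noteq> \<eta> t}"
  have "\<exists>e>0. \<forall>t'. dist t' t < e \<longrightarrow> t' \<in> E" if "t \<in> E" for t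
    using integral_curve_locally_unique[OF A X I(1) \<gamma> \<eta>, of t] that
    by (auto simp: E_def dist_real_def)
  then have "open E" by (simp add: open_dist)
  moreover have "\<exists>T. open T \<and> t \<in> T \<and> T \<subseteq> N" if t: "t \<in> N" for t
  proof -
    obtain U V where UV: "open U" "open V" "\<gamma> t \<in> U" "\<eta> t \<in> V" "U \<inter> V = {}"
      using t hausdorff[of "\<gamma> t" "\<eta> t"] by (auto simp: N_def)
    have "open (\<gamma> -` U \<inter> I)" "open (\<eta> -` V \<inter> I)"
      using \<gamma> \<eta> UV continuous_on_open_vimage[OF I(1)] by (auto simp: integral_curve_on_def)
    then have "open ((\<gamma> -` U \<inter> I) \<inter> (\<eta> -` V \<inter> I))" by blast
    moreover have "t \<in> (\<gamma> -` U \<inter> I) \<inter> (\<eta> -` V \<inter> I)"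
      using UV t by (auto simp: N_def)
    moreover have "(\<gamma> -` U \<inter> I) \<inter> (\<eta> -` V \<inter> I) \<subseteq> N"
      using UV by (auto simp: N_def)
    ultimately show ?thesis by blast
  qed
  then have "open N" using open_subopen by blast
  moreover have "E \<inter> N \<inter> I = {}" "I \<subseteq> E \<union> N" "s \<in> E \<inter> I"
    using s by (auto simp: E_def N_def)
  ultimately have "N \<inter> I = {}"
    using connectedD[OF I(2), of E N] by blast
  then show ?thesis
    using t by (auto simp: N_def)
qed

lemma integral_curve_on_subset:
  "integral_curve_on A X I \<gamma> \<Longrightarrow> J \<subseteq> I \<Longrightarrow> integral_curve_on A X J \<gamma>"
  by (auto simp: integral_curve_on_def intro: continuous_on_subset)

lemma integral_curve_on_shift:
  assumes "integral_curve_on A X I \<gamma>" and sub: "(\<lambda>t. s + t) ` J \<subseteq> I"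
  shows "integral_curve_on A X J (\<lambda>t. \<gamma> (s + t))"
  unfolding integral_curve_on_def
proof (intro conjI ballI impI)
  have "continuous_on I \<gamma>" using assms by (simp add: integral_curve_on_def)
  then show "continuous_on J (\<lambda>t. \<gamma> (s + t))"
    by (rule continuous_on_compose2[OF _ _ sub]) (intro continuous_intros)
next
  fix t c assume t: "t \<in> J" and c: "c \<in> A" "\<gamma> (s + t) \<in> fst c"
  have "((\<lambda>u. snd c (\<gamma> u)) has_vector_derivative X (\<gamma> (s + t)) c) (at (s + t))"
    using assms t c by (auto simp: integral_curve_on_def)
  moreover have "((\<lambda>t. s + t) has_vector_derivative 1) (at t)"
    by (auto intro!: derivative_eq_intros)
  ultimately show "((\<lambda>t. snd c (\<gamma> (s + t))) has_vector_derivative X (\<gamma> (s + t)) c) (at t)"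
    using vector_diff_chain_at[of "\<lambda>t. s + t" 1 t "\<lambda>u. snd c (\<gamma> u)"] by (simp add: o_def)
qed

lemma local_flow_integral_curve:
  assumes "local_flow A X \<epsilon> U \<phi>" "q \<in> U"
  shows "integral_curve_on A X {-\<epsilon><..<\<epsilon>} (\<lambda>t. \<phi> t q)"
proof -
  have "continuous_on ({-\<epsilon><..<\<epsilon>} \<times> U) (\<lambda>(t, p). \<phi> t p)"
    using assms by (simp add: local_flow_def smooth_map_on_def)
  then have "continuous_on {-\<epsilon><..<\<epsilon>} (\<lambda>t. (\<lambda>(t, p). \<phi> t p) (t, q))"
    by (rule continuous_on_compose2) (use assms(2) in \<open>auto intro!: continuous_intros\<close>)
  then show ?thesis
    using assms by (simp add: local_flow_def integral_curve_on_def)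
qed


section \<open>Lie groups\<close>

locale lie_group_on = group G for G :: "('g::t2_space, 'x) monoid_scheme" (structure) +
  fixes A :: "('g, 'e::euclidean_space) chart set"
  assumes lie_group: "lie_group G A"
begin

lemma atlas: "smooth_atlas A"
  using lie_group by (simp add: lie_group_def)

lemmas cover = smooth_atlas_charts_cover[OF atlas]

lemma in_carrier [simp]: "x \<in> carrier G"
  using lie_group by (simp add: lie_group_def)

lemma inv_cancel_left: "inv x \<otimes> (x \<otimes> y) = y" "x \<otimes> (inv x \<otimes> y) = y"
  by (simp_all flip: m_assoc)

lemma differentiable_mult: "differentiable_map (prod_atlas A A) A (\<lambda>(x, y). x \<otimes> y)"
  using lie_group smooth_map_on_differentiable_map by (auto simp: lie_group_def)

lemma differentiable_map_mult:
  assumes "differentiable_map A A f" "differentiable_map A A g"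
  shows "differentiable_map A A (\<lambda>x. f x \<otimes> g x)"
  using differentiable_map_comp[OF atlas charts_cover_prod_atlas[OF cover cover]
      differentiable_map_Pair[OF assms] differentiable_mult]
  by (simp add: o_def)

lemma differentiable_map_inv:
  assumes "differentiable_map A A f"
  shows "differentiable_map A A (\<lambda>x. inv (f x))"
proof -
  have "differentiable_map A A (\<lambda>x. inv x)"
    using lie_group smooth_map_on_differentiable_map by (auto simp: lie_group_def)
  from differentiable_map_comp[OF atlas cover assms this] show ?thesis
    by (simp add: o_def)
qed

lemma differentiable_map_ident: "differentiable_map A A (\<lambda>x. x)"
  using differentiable_map_id[OF atlas] by (simp add: id_def)

lemmas differentiable_intros =
  differentiable_map_mult differentiable_map_inv differentiable_map_ident differentiable_map_const

text \<open>The derivative \<open>M\<close> of the multiplication at \<open>(1, 1)\<close> is \<open>(a, b) \<mapsto> a + b\<close>: by linearity it is determined by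
  its values on \<open>(a, 0)\<close> and \<open>(0, b)\<close>, and these come from \<open>x 1 = x\<close> and \<open>1 x = x\<close>.\<close>

lemma chart_deriv_mult_at_one:
  assumes c: "c \<in> A" "\<one> \<in> fst c"
    and f: "differentiable_map A A f" "f \<one> = \<one>" and g: "differentiable_map A A g" "g \<one> = \<one>"
  shows "chart_deriv c c (\<lambda>x. f x \<otimes> g x) \<one> v = chart_deriv c c f \<one> v + chart_deriv c c g \<one> v"
proof -
  let ?cc = "(fst c \<times> fst c, map_prod (snd c) (snd c))"
  define M where "M = chart_deriv ?cc c (\<lambda>(x, y). x \<otimes> y) (\<one>, \<one>)"
  have cc: "?cc \<in> prod_atlas A A"
    unfolding prod_atlas_def using c by blast
  have M: "chart_deriv c c (\<lambda>x. f x \<otimes> g x) \<one> v = M (chart_deriv c c f \<one> v, chart_deriv c c g \<one> v)"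
    if f: "differentiable_map A A f" "f \<one> = \<one>" and g: "differentiable_map A A g" "g \<one> = \<one>"
    for f g v
  proof -
    have "chart_deriv c c ((\<lambda>(x, y). x \<otimes> y) \<circ> (\<lambda>x. (f x, g x))) \<one> v =
        chart_deriv ?cc c (\<lambda>(x, y). x \<otimes> y) (f \<one>, g \<one>) (chart_deriv c ?cc (\<lambda>x. (f x, g x)) \<one> v)"
      by (rule chart_deriv_comp[OF atlas charts_cover_prod_atlas[OF cover cover]
            differentiable_map_Pair[OF f(1) g(1)] differentiable_mult c cc _ c(1)])
        (use c f g in auto)
    moreover have "(local_rep c ?cc (\<lambda>x. (f x, g x)) has_derivative
        (\<lambda>v. (chart_deriv c c f \<one> v, chart_deriv c c g \<one> v))) (at (snd c \<one>))"
      unfolding local_rep_Pair using c f g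
      by (intro has_derivative_Pair differentiable_map_has_derivative) auto
    from frechet_derivative_at[OF this]
    have "chart_deriv c ?cc (\<lambda>x. (f x, g x)) \<one> v = (chart_deriv c c f \<one> v, chart_deriv c c g \<one> v)"
      by metis
    ultimately show ?thesis
      using f g by (simp add: o_def M_def)
  qed
  have "(local_rep ?cc c (\<lambda>(x, y). x \<otimes> y) has_derivative M) (at (snd ?cc (\<one>, \<one>)))"
    unfolding M_def using c
    by (intro differentiable_map_has_derivative[OF differentiable_mult cc]) auto
  then have "linear M"
    by (rule has_derivative_linear)
  then have "M (a, b) = M (a, 0) + M (0, b)" for a b
    using linear_add[of M "(a, 0)" "(0, b)"] by simp
  moreover have "M (a, 0) = a" for a
    using M[OF differentiable_map_ident _ differentiable_map_const, of \<one> a]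
      chart_deriv_id[OF atlas c] chart_deriv_const[of c c "\<one>" "\<one>" a] by (simp add: id_def)
  moreover have "M (0, b) = b" for b
    using M[OF differentiable_map_const _ differentiable_map_ident, of \<one> b]
      chart_deriv_id[OF atlas c] chart_deriv_const[of c c "\<one>" "\<one>" b] by (simp add: id_def)
  ultimately show ?thesis
    using M[OF f g] by simp
qed

lemma commutator_iterate_in_lower_central_series:
  "((\<lambda>x. x \<otimes> b \<otimes> inv x \<otimes> inv b) ^^ k) x \<in> lower_central_series G k"
proof (induction k)
  case (Suc k)
  let ?y = "((\<lambda>x. x \<otimes> b \<otimes> inv x \<otimes> inv b) ^^ k) x"
  have "?y \<otimes> b \<otimes> inv ?y \<otimes> inv b \<in> (\<Union>x\<in>lower_central_series G k. \<Union>y\<in>carrier G.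
      {x \<otimes> y \<otimes> inv x \<otimes> inv y})"
    using Suc.IH in_carrier[of b] by blast
  then show ?case
    by (simp add: generate.incl)
qed simp

text \<open>Unipotency of \<open>Ad(b)\<close>, in the weak form of a nonzero fixed vector. The commutator map \<open>\<kappa>\<close> has
  derivative \<open>D = I - Ad(b)\<close> at \<open>1\<close>, because \<open>\<kappa>(x) \<cdot> (b x b\<^sup>-\<^sup>1) = x\<close>, and \<open>D\<close> is nilpotent because an iterate
  of \<open>\<kappa>\<close> is constant.\<close>

lemma conjugation_fixes_coordinate_vector:
  assumes nil: "nilpotent_group G" and c: "c \<in> A" "\<one> \<in> fst c"
  shows "\<exists>v. v \<noteq> 0 \<and> chart_deriv c c (\<lambda>x. b \<otimes> x \<otimes> inv b) \<one> v = v"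
proof -
  define \<kappa> where "\<kappa> = (\<lambda>x. x \<otimes> b \<otimes> inv x \<otimes> inv b)"
  define C where "C = (\<lambda>x. b \<otimes> x \<otimes> inv b)"
  define D where "D = chart_deriv c c \<kappa> \<one>"
  have \<kappa>: "differentiable_map A A \<kappa>" "\<kappa> \<one> = \<one>" and C: "differentiable_map A A C" "C \<one> = \<one>"
    unfolding \<kappa>_def C_def by (intro differentiable_intros, simp add: m_assoc)+
  have "\<kappa> x \<otimes> C x = x" for x
    unfolding \<kappa>_def C_def by (simp add: m_assoc inv_cancel_left)
  then have split: "D v + chart_deriv c c C \<one> v = v" for v
    using chart_deriv_mult_at_one[OF c \<kappa> C, of v] chart_deriv_id[OF atlas c, of v]
    by (simp add: D_def id_def)
  have iter: "differentiable_map A A (\<kappa> ^^ k) \<and> (\<kappa> ^^ k) \<one> = \<one> \<and>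
      chart_deriv c c (\<kappa> ^^ k) \<one> = (D ^^ k)" for k
  proof (induction k)
    case 0
    show ?case
      using differentiable_map_id[OF atlas] chart_deriv_id[OF atlas c] by (auto simp: id_def)
  next
    case (Suc k)
    then have k: "differentiable_map A A (\<kappa> ^^ k)" "(\<kappa> ^^ k) \<one> = \<one>"
        "chart_deriv c c (\<kappa> ^^ k) \<one> = (D ^^ k)" by auto
    have "chart_deriv c c (\<kappa> \<circ> (\<kappa> ^^ k)) \<one> v = (D ^^ Suc k) v" for v
      using chart_deriv_comp[OF atlas cover k(1) \<kappa>(1) c c(1) _ c(1), of v] k \<kappa> c
      by (simp add: D_def)
    then have "chart_deriv c c (\<kappa> ^^ Suc k) \<one> = (D ^^ Suc k)"
      unfolding funpow.simps by blast
    moreover have "differentiable_map A A (\<kappa> ^^ Suc k)"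
      unfolding funpow.simps by (rule differentiable_map_comp[OF atlas cover k(1) \<kappa>(1)])
    moreover have "(\<kappa> ^^ Suc k) \<one> = \<one>"
      using k \<kappa> by simp
    ultimately show ?case by blast
  qed
  obtain k where "lower_central_series G k = {\<one>}"
    using nil by (auto simp: nilpotent_group_def)
  then have "\<kappa> ^^ k = (\<lambda>_. \<one>)"
    using commutator_iterate_in_lower_central_series[where b = b and k = k] by (auto simp: \<kappa>_def)
  then have vanish: "(D ^^ k) v = 0" for v
    using iter[of k] chart_deriv_const[of c c "\<one>" "\<one>" v] by metis
  obtain u :: 'e where u: "u \<noteq> 0"
    using nonzero_Basis SOME_Basis by blast
  \<comment> \<open>The last nonzero vector of the sequence \<open>u, D u, D (D u), \<dots>\<close> lies in the kernel of \<open>D\<close>.\<close>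
  define j where "j = (LEAST j. (D ^^ j) u = 0)"
  have j: "(D ^^ j) u = 0" and least: "\<And>i. i < j \<Longrightarrow> (D ^^ i) u \<noteq> 0"
    using LeastI[of "\<lambda>j. (D ^^ j) u = 0" k] vanish not_less_Least unfolding j_def by blast+
  obtain i where i: "j = Suc i"
    using j u by (cases j) auto
  define v where "v = (D ^^ i) u"
  have "v \<noteq> 0" "D v = 0"
    using j least[of i] by (simp_all add: v_def i)
  then show ?thesis
    using split[of v] by (auto simp: C_def)
qed

lemma conjugation_fixes_tangent_vector:
  assumes nil: "nilpotent_group G"
  shows "\<exists>V\<in>tangent_space A \<one>. V \<noteq> (\<lambda>c. 0) \<and> differential A A (\<lambda>x. b \<otimes> x \<otimes> inv b) \<one> V = V"
proof -
  let ?C = "\<lambda>x. b \<otimes> x \<otimes> inv b"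
  obtain c where c: "c \<in> A" "\<one> \<in> fst c"
    using cover by (rule charts_coverE)
  obtain v where v: "v \<noteq> 0" "chart_deriv c c ?C \<one> v = v"
    using conjugation_fixes_coordinate_vector[OF nil c] by blast
  define V where "V = tangent_of_coords A c \<one> v"
  have V: "V \<in> tangent_space A \<one>" "V c = v"
    unfolding V_def using tangent_of_coords_in_tangent_space[OF atlas c]
      tangent_of_coords_chart[OF atlas c] by auto
  have C: "differentiable_map A A ?C" "?C \<one> = \<one>"
    by (intro differentiable_intros, simp)
  have "differential A A ?C \<one> V = V"
  proof (rule tangent_eqI[OF _ V(1) c])
    show "differential A A ?C \<one> V \<in> tangent_space A \<one>"
      using differential_in_tangent_space[OF atlas atlas C(1) V(1)] C(2) by simp
    show "differential A A ?C \<one> V c = V c"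
      using differential_chart[OF atlas C(1) V(1) c c(1)] C(2) c v V(2) by simp
  qed
  moreover have "V \<noteq> (\<lambda>c. 0)" using v V by auto
  ultimately show ?thesis using V by blast
qed


section \<open>Left-invariant fields and metrics\<close>

abbreviation (input) left_mult :: "'g \<Rightarrow> 'g \<Rightarrow> 'g" where "left_mult g \<equiv> \<lambda>x. g \<otimes> x"
abbreviation (input) right_mult :: "'g \<Rightarrow> 'g \<Rightarrow> 'g" where "right_mult a \<equiv> \<lambda>x. x \<otimes> a"

lemma integral_curve_left_translate:
  assumes X: "left_invariant_field G A X" and I: "open I" and \<gamma>: "integral_curve_on A X I \<gamma>"
  shows "integral_curve_on A X I (\<lambda>t. g \<otimes> \<gamma> t)"
  unfolding integral_curve_on_def
proof (intro conjI ballI impI)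
  have L: "differentiable_map A A (left_mult g)"
    by (intro differentiable_intros)
  have cont: "continuous_on I \<gamma>"
    using \<gamma> by (simp add: integral_curve_on_def)
  show "continuous_on I (\<lambda>t. g \<otimes> \<gamma> t)"
    by (rule continuous_on_compose2[of UNIV "left_mult g"])
      (use L cont in \<open>auto simp: differentiable_map_def\<close>)
  fix t d assume t: "t \<in> I" and d: "d \<in> A" "g \<otimes> \<gamma> t \<in> fst d"
  obtain c where c: "c \<in> A" "\<gamma> t \<in> fst c"
    using cover by (rule charts_coverE)
  have Xt: "X (\<gamma> t) \<in> tangent_space A (\<gamma> t)"
    using X by (auto simp: left_invariant_field_def smooth_vector_field_def)
  have "((\<lambda>s. snd c (\<gamma> s)) has_vector_derivative X (\<gamma> t) c) (at t)"
    using \<gamma> t c by (auto simp: integral_curve_on_def)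
  moreover have "(local_rep c d (left_mult g) has_derivative chart_deriv c d (left_mult g) (\<gamma> t))
      (at (snd c (\<gamma> t)))"
    using differentiable_map_has_derivative[OF L c(1) d(1) c(2)] d(2) by simp
  ultimately have "(local_rep c d (left_mult g) \<circ> (\<lambda>s. snd c (\<gamma> s)) has_vector_derivative
      chart_deriv c d (left_mult g) (\<gamma> t) (X (\<gamma> t) c)) (at t)"
    by (intro vector_derivative_diff_chain_within) (auto intro: has_derivative_at_withinI)
  also have "chart_deriv c d (left_mult g) (\<gamma> t) (X (\<gamma> t) c) = X (g \<otimes> \<gamma> t) d"
    using differential_chart[OF atlas L Xt c d(1)] d(2) X by (simp add: left_invariant_field_def)
  finally have *: "(local_rep c d (left_mult g) \<circ> (\<lambda>s. snd c (\<gamma> s)) has_vector_derivative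
      X (g \<otimes> \<gamma> t) d) (at t)" .
  have "open (fst c)"
    using cover c by (simp add: charts_cover_def)
  then have S: "open (\<gamma> -` fst c \<inter> I)" "t \<in> \<gamma> -` fst c \<inter> I"
    using cont continuous_on_open_vimage[OF I] t c by auto
  show "((\<lambda>s. snd d (g \<otimes> \<gamma> s)) has_vector_derivative X (g \<otimes> \<gamma> t) d) (at t)"
    by (rule has_vector_derivative_transform_within_open[OF * S])
      (simp add: local_rep_chart[OF cover c(1)])
qed

text \<open>Both \<open>t \<mapsto> \<phi>\<^sub>t q\<close> and \<open>t \<mapsto> q a\<^sub>t\<close> are integral curves that start at \<open>q\<close>, the second one as a left translate of
  the integral curve \<open>a\<close>.\<close>

lemma left_invariant_flow_is_right_translation:
  assumes X: "left_invariant_field G A X" and \<phi>: "local_flow A X \<epsilon> U \<phi>" and p: "p \<in> U"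
  defines "a \<equiv> \<lambda>t. inv p \<otimes> \<phi> t p"
  shows "integral_curve_on A X {-\<epsilon><..<\<epsilon>} a" "a 0 = \<one>"
    and "\<And>t q. t \<in> {-\<epsilon><..<\<epsilon>} \<Longrightarrow> q \<in> U \<Longrightarrow> \<phi> t q = q \<otimes> a t"
proof -
  have I: "open {-\<epsilon><..<\<epsilon>}" "connected {-\<epsilon><..<\<epsilon>}" "0 \<in> {-\<epsilon><..<\<epsilon>}"
    and init: "\<And>q. q \<in> U \<Longrightarrow> \<phi> 0 q = q"
    using \<phi> by (auto simp: local_flow_def)
  show a: "integral_curve_on A X {-\<epsilon><..<\<epsilon>} a"
    unfolding a_def
    by (rule integral_curve_left_translate[OF X I(1) local_flow_integral_curve[OF \<phi> p]])
  show a0: "a 0 = \<one>"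
    using init[OF p] by (simp add: a_def)
  have sX: "smooth_vector_field A X"
    using X by (simp add: left_invariant_field_def)
  show "\<phi> t q = q \<otimes> a t" if "t \<in> {-\<epsilon><..<\<epsilon>}" "q \<in> U" for t q
    by (rule integral_curve_unique[OF atlas sX I(1,2) local_flow_integral_curve[OF \<phi> that(2)]
          integral_curve_left_translate[OF X I(1) a] I(3) _ that(1)])
      (simp add: a0 init[OF that(2)])
qed

lemma pullback_comp:
  assumes f: "differentiable_map A A f" and g: "differentiable_map A A g"
    and "v \<in> tangent_space A p" "w \<in> tangent_space A p"
  shows "pullback A (g \<circ> f) h p v w =
    pullback A g h (f p) (differential A A f p v) (differential A A f p w)"
  using assms by (simp add: pullback_def differential_comp[OF atlas atlas atlas f g])

lemma pullback_left_mult_comp: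
  assumes h: "left_invariant_metric G A h" and f: "differentiable_map A A f"
    and v: "v \<in> tangent_space A p" and w: "w \<in> tangent_space A p"
  shows "pullback A (\<lambda>x. g \<otimes> f x) h p v w = pullback A f h p v w"
proof -
  have "pullback A (left_mult g \<circ> f) h p v w =
      pullback A (left_mult g) h (f p) (differential A A f p v) (differential A A f p w)"
    by (intro pullback_comp differentiable_intros f v w)
  also have "\<dots> = pullback A f h p v w"
    using h differential_in_tangent_space[OF atlas atlas f v]
      differential_in_tangent_space[OF atlas atlas f w]
    by (simp add: left_invariant_metric_def pullback_def[of A f])
  finally show ?thesis by (simp add: o_def)
qed

text \<open>The vector is the left translate \<open>v\<close> to \<open>p\<close> of a fixed vector \<open>V\<close> of \<open>Ad(a\<^sup>-\<^sup>1)\<close>. Writing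
  \<open>p x a = (p a) (a\<^sup>-\<^sup>1 x a)\<close>, the image of \<open>v\<close> under right translation by \<open>a\<close> is the left translate of
  \<open>Ad(a\<^sup>-\<^sup>1) V = V\<close> to \<open>p a\<close>, and left translations are isometries.\<close>

lemma right_mult_preserves_some_length:
  assumes nil: "nilpotent_group G" and h: "left_invariant_metric G A h" "riemannian_metric A h"
  shows "\<exists>v\<in>tangent_space A p. h p v v > 0 \<and> pullback A (right_mult a) h p v v = h p v v"
proof -
  let ?C = "\<lambda>x. inv a \<otimes> x \<otimes> inv (inv a)"
  obtain V where V: "V \<in> tangent_space A \<one>" "V \<noteq> (\<lambda>c. 0)" "differential A A ?C \<one> V = V"
    using conjugation_fixes_tangent_vector[OF nil, of "inv a"] by blast
  define v where "v = differential A A (left_mult p) \<one> V"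
  have L: "differentiable_map A A (left_mult p)" and R: "differentiable_map A A (right_mult a)"
    and C: "differentiable_map A A ?C"
    by (intro differentiable_intros)+
  have v: "v \<in> tangent_space A p"
    using differential_in_tangent_space[OF atlas atlas L V(1)] by (simp add: v_def)
  have "h p v v = pullback A (left_mult p) h \<one> V V"
    by (simp add: pullback_def v_def)
  then have len: "h p v v = h \<one> V V"
    using h V by (simp add: left_invariant_metric_def)
  have "pullback A (right_mult a) h p v v = pullback A (right_mult a \<circ> left_mult p) h \<one> V V"
    by (simp add: pullback_comp[OF L R V(1) V(1)] v_def)
  also have "right_mult a \<circ> left_mult p = (\<lambda>x. (p \<otimes> a) \<otimes> ?C x)"
    by (auto simp: m_assoc inv_cancel_left)
  also have "pullback A \<dots> h \<one> V V = pullback A ?C h \<one> V V"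
    by (rule pullback_left_mult_comp[OF h(1) C V(1) V(1)])
  also have "\<dots> = h \<one> V V"
    unfolding pullback_def V(3) by simp
  finally have "pullback A (right_mult a) h p v v = h p v v"
    using len by simp
  moreover have "h \<one> V V > 0"
    using h(2) V by (simp add: riemannian_metric_def)
  ultimately show ?thesis
    using v len by (intro bexI[of _ v] conjI) simp_all
qed

lemma pullback_flow_eq_pullback_right_mult:
  assumes X: "left_invariant_field G A X" and \<phi>: "local_flow A X \<epsilon> U \<phi>" and p: "p \<in> U"
    and q: "q \<in> U" and t: "t \<in> {-\<epsilon><..<\<epsilon>}"
  shows "pullback A (\<phi> t) h q v w = pullback A (right_mult (inv p \<otimes> \<phi> t p)) h q v w"
proof -
  have U: "open U" using \<phi> by (simp add: local_flow_def)
  have eq: "\<phi> t x = right_mult (inv p \<otimes> \<phi> t p) x" if "x \<in> U" for x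
    using left_invariant_flow_is_right_translation(3)[OF X \<phi> p t that] .
  have "differential A A (\<phi> t) q u = differential A A (right_mult (inv p \<otimes> \<phi> t p)) q u" for u
    by (rule differential_cong_open[OF atlas U q eq])
  then show ?thesis
    using eq[OF q] by (simp add: pullback_def)
qed

text \<open>At each point the conformal factor is read off on the vector whose length the flow preserves; it is
  therefore \<open>1\<close>, and the pullback of the metric does not depend on time.\<close>

lemma conformal_imp_killing:
  assumes nil: "nilpotent_group G" and h: "left_invariant_metric G A h" "riemannian_metric A h"
    and X: "left_invariant_field G A X" and conf: "conformal_field A h X"
  shows "killing_field A h X"
  unfolding killing_field_def
proof (intro conjI allI ballI)
  show "smooth_vector_field A X"
    using X by (simp add: left_invariant_field_def)
  fix p v w assume v: "v \<in> tangent_space A p" and w: "w \<in> tangent_space A p"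
  obtain \<epsilon> U \<phi> \<psi> where \<phi>: "local_flow A X \<epsilon> U \<phi>" and p: "p \<in> U"
    and \<psi>: "\<And>t v w. t \<in> {-\<epsilon><..<\<epsilon>} \<Longrightarrow> v \<in> tangent_space A p \<Longrightarrow> w \<in> tangent_space A p \<Longrightarrow>
        pullback A (\<phi> t) h p v w = exp (2 * \<psi> t p) * h p v w"
    using conf unfolding conformal_field_def by metis
  have const: "pullback A (\<phi> t) h p v w = h p v w" if t: "t \<in> {-\<epsilon><..<\<epsilon>}" for t
  proof -
    obtain u where u: "u \<in> tangent_space A p" "h p u u > 0"
      "pullback A (right_mult (inv p \<otimes> \<phi> t p)) h p u u = h p u u"
      using right_mult_preserves_some_length[OF nil h] by blast
    then have "exp (2 * \<psi> t p) * h p u u = h p u u"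
      using \<psi>[OF t u(1) u(1)] pullback_flow_eq_pullback_right_mult[OF X \<phi> p p t] by simp
    then have "exp (2 * \<psi> t p) = 1"
      using u(2) by simp
    then show ?thesis
      using \<psi>[OF t v w] by simp
  qed
  have "((\<lambda>t. pullback A (\<phi> t) h p v w) has_real_derivative 0) (at 0)"
    by (rule has_field_derivative_transform_within_open[where S = "{-\<epsilon><..<\<epsilon>}" and
          f = "\<lambda>_. h p v w"])
      (use \<phi> const in \<open>auto simp: local_flow_def\<close>)
  then show "has_lie_derivative_metric A X h p v w 0"
    using \<phi> p unfolding has_lie_derivative_metric_def by blast
qed

text \<open>The derivative at time \<open>s\<close> at the point \<open>p\<close> is the derivative at time \<open>0\<close> at the point \<open>p' = p a\<^sub>s\<close>, applied to
  the images \<open>v'\<close>, \<open>w'\<close> of \<open>v\<close>, \<open>w\<close>. This is the one-parameter group law \<open>a\<^bsub>s+t\<^esub> = a\<^sub>s a\<^sub>t\<close>. The Lie derivative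
  at \<open>p'\<close> is taken along a flow \<open>\<phi>'\<close> of its own, whose curve \<open>b\<close> of group elements agrees with \<open>a\<close> near
  time \<open>0\<close>.\<close>

lemma killing_flow_derivative_zero:
  assumes X: "left_invariant_field G A X" and kill: "killing_field A h X"
    and \<phi>: "local_flow A X \<epsilon> U \<phi>" and p: "p \<in> U" and s: "s \<in> {-\<epsilon><..<\<epsilon>}"
    and v: "v \<in> tangent_space A p" and w: "w \<in> tangent_space A p"
  shows "((\<lambda>t. pullback A (\<phi> t) h p v w) has_real_derivative 0) (at s)"
proof -
  have sX: "smooth_vector_field A X"
    using X by (simp add: left_invariant_field_def)
  define a where "a = (\<lambda>t. inv p \<otimes> \<phi> t p)"
  have a: "integral_curve_on A X {-\<epsilon><..<\<epsilon>} a" "a 0 = \<one>"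
    using left_invariant_flow_is_right_translation(1,2)[OF X \<phi> p] by (simp_all add: a_def)
  define p' where "p' = p \<otimes> a s"
  define v' where "v' = differential A A (right_mult (a s)) p v"
  define w' where "w' = differential A A (right_mult (a s)) p w"
  have R: "differentiable_map A A (right_mult b)" for b
    by (intro differentiable_intros)
  have "v' \<in> tangent_space A p'" "w' \<in> tangent_space A p'"
    unfolding v'_def w'_def p'_def
    using differential_in_tangent_space[OF atlas atlas R] v w by auto
  then have "has_lie_derivative_metric A X h p' v' w' 0"
    using kill by (simp add: killing_field_def)
  then obtain \<epsilon>' U' \<phi>' where \<phi>': "local_flow A X \<epsilon>' U' \<phi>'" "p' \<in> U'"
    and deriv: "((\<lambda>t. pullback A (\<phi>' t) h p' v' w') has_real_derivative 0) (at 0)"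
    unfolding has_lie_derivative_metric_def by blast
  define b where "b = (\<lambda>t. inv p' \<otimes> \<phi>' t p')"
  have b: "integral_curve_on A X {-\<epsilon>'<..<\<epsilon>'} b" "b 0 = \<one>"
    using left_invariant_flow_is_right_translation(1,2)[OF X \<phi>'] by (simp_all add: b_def)
  \<comment> \<open>For \<open>\<bar>t\<bar> < \<delta>\<close> the elements \<open>b t\<close>, \<open>a t\<close> and \<open>a (s + t)\<close> are all within the times of their flows.\<close>
  define \<delta> where "\<delta> = min \<epsilon>' (\<epsilon> - \<bar>s\<bar>)"
  define J where "J = {-\<delta><..<\<delta>}"
  have J: "open J" "connected J" "0 \<in> J" "J \<subseteq> {-\<epsilon>'<..<\<epsilon>'}" "J \<subseteq> {-\<epsilon><..<\<epsilon>}"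
    "(\<lambda>t. s + t) ` J \<subseteq> {-\<epsilon><..<\<epsilon>}"
    using s \<phi>' by (auto simp: J_def \<delta>_def local_flow_def)
  have a_J: "integral_curve_on A X J a"
    by (rule integral_curve_on_subset[OF a(1) J(5)])
  have b_eq: "b t = a t" if "t \<in> J" for t
    by (rule integral_curve_unique[OF atlas sX J(1,2) integral_curve_on_subset[OF b(1) J(4)]
          a_J J(3) _ that]) (simp add: a(2) b(2))
  have hom: "a (s + t) = a s \<otimes> a t" if "t \<in> J" for t
    by (rule integral_curve_unique[OF atlas sX J(1,2) integral_curve_on_shift[OF a(1) J(6)]
          integral_curve_left_translate[OF X J(1) a_J] J(3) _ that]) (simp add: a(2))
  have shift: "pullback A (\<phi>' t) h p' v' w' = pullback A (\<phi> (s + t)) h p v w" if t: "t \<in> J" for t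
  proof -
    have "s + t \<in> {-\<epsilon><..<\<epsilon>}" using J(6) t by blast
    then have "pullback A (\<phi> (s + t)) h p v w = pullback A (right_mult (a (s + t))) h p v w"
      unfolding a_def by (rule pullback_flow_eq_pullback_right_mult[OF X \<phi> p p])
    also have "right_mult (a (s + t)) = right_mult (a t) \<circ> right_mult (a s)"
      by (auto simp: hom[OF t] m_assoc)
    also have "pullback A \<dots> h p v w = pullback A (right_mult (b t)) h p' v' w'"
      unfolding b_eq[OF t] v'_def w'_def p'_def by (rule pullback_comp[OF R R v w])
    also have "\<dots> = pullback A (\<phi>' t) h p' v' w'"
      unfolding b_def
      by (rule pullback_flow_eq_pullback_right_mult[OF X \<phi>' \<phi>'(2), symmetric]) (use t J in blast)
    finally show ?thesis by simp
  qed
  have "((\<lambda>t. pullback A (\<phi> (s + t)) h p v w) has_real_derivative 0) (at 0)"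
    by (rule has_field_derivative_transform_within_open[OF deriv J(1,3) shift])
  then show ?thesis
    using DERIV_shift[of "\<lambda>t. pullback A (\<phi> t) h p v w" 0 0 s] by (simp add: add.commute)
qed

lemma killing_flow_isometric:
  assumes X: "left_invariant_field G A X" and kill: "killing_field A h X"
    and \<phi>: "local_flow A X \<epsilon> U \<phi>" and p: "p \<in> U" and t: "t \<in> {-\<epsilon><..<\<epsilon>}"
    and v: "v \<in> tangent_space A p" and w: "w \<in> tangent_space A p"
  shows "pullback A (\<phi> t) h p v w = h p v w"
proof -
  have "pullback A (\<phi> t) h p v w = pullback A (\<phi> 0) h p v w"
    by (rule DERIV_isconst3[of "-\<epsilon>" \<epsilon>])
      (use t \<phi> killing_flow_derivative_zero[OF X kill \<phi> p _ v w] in \<open>auto simp: local_flow_def\<close>)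
  also have "pullback A (\<phi> 0) h p v w = h p v w"
  proof -
    have U: "open U" and id: "\<And>q. q \<in> U \<Longrightarrow> \<phi> 0 q = id q"
      using \<phi> by (auto simp: local_flow_def)
    have "differential A A (\<phi> 0) p u = differential A A id p u" for u
      by (rule differential_cong_open[OF atlas U p id])
    then show ?thesis
      using id[OF p] by (simp add: pullback_def differential_id[OF atlas] v w)
  qed
  finally show ?thesis .
qed

lemma killing_imp_conformal:
  assumes X: "left_invariant_field G A X" and kill: "killing_field A h X"
  shows "conformal_field A h X"
  unfolding conformal_field_def
proof (intro conjI allI)
  show "smooth_vector_field A X"
    using X by (simp add: left_invariant_field_def)
  fix p
  \<comment> \<open>The Lie derivative on any pair of vectors, such as the zero vectors, comes with a local flow.\<close>
  have "has_lie_derivative_metric A X h p (\<lambda>c. 0) (\<lambda>c. 0) 0"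
    using kill zero_in_tangent_space[OF atlas] by (simp add: killing_field_def)
  then obtain \<epsilon> U \<phi> where \<phi>: "local_flow A X \<epsilon> U \<phi>" "p \<in> U"
    unfolding has_lie_derivative_metric_def by blast
  have "\<forall>t\<in>{-\<epsilon><..<\<epsilon>}. smooth_map_on A euclidean_atlas U (\<lambda>_. 0::real) \<and>
      (\<forall>q\<in>U. \<forall>v\<in>tangent_space A q. \<forall>w\<in>tangent_space A q.
        pullback A (\<phi> t) h q v w = exp (2 * 0) * h q v w)"
    using killing_flow_isometric[OF X kill \<phi>(1)] by (simp add: smooth_map_on_const)
  then show "\<exists>\<epsilon> U \<phi>. local_flow A X \<epsilon> U \<phi> \<and> p \<in> U \<and>
        (\<exists>\<psi>. \<forall>t\<in>{-\<epsilon><..<\<epsilon>}.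
           smooth_map_on A euclidean_atlas U (\<psi> t) \<and>
           (\<forall>q\<in>U. \<forall>v\<in>tangent_space A q. \<forall>w\<in>tangent_space A q.
              pullback A (\<phi> t) h q v w = exp (2 * \<psi> t q) * h q v w))"
    using \<phi> by (intro exI[of _ \<epsilon>] exI[of _ U] exI[of _ \<phi>] conjI exI[of _ "\<lambda>_ _. 0"])
qed

end

theorem theorem3:
  fixes G :: "('g::{t2_space, second_countable_topology}, 'x) monoid_scheme"
    and A :: "('g, 'e::euclidean_space) chart set"
    and h :: "('g, 'e) metric"
    and n :: nat
  assumes "lie_group G A"
    and "DIM('e) = n"
    and "simply_connected (UNIV :: 'g set)"
    and "nilpotent_group G"
    and "riemannian_metric A h"
    and "left_invariant_metric G A h"
  shows "{X. left_invariant_field G A X \<and> conformal_field A h X} =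
         {X. left_invariant_field G A X \<and> killing_field A h X}"
proof -
  interpret group G
    using assms(1) by (simp add: lie_group_def)
  interpret lie_group_on G A
    by unfold_locales (fact assms(1))
  show ?thesis
    using conformal_imp_killing[OF assms(4,6,5)] killing_imp_conformal by blast
qed

end
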